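(* For each $\varepsilon\in(0,1)$ and each positive integer $n\ge n_0(\varepsilon):=\left(\frac{1.0085\, e}{\varepsilon}\right)^2$, we have $\mathcal{S}_n\subset D_{1+\varepsilon}$.
   Context: For a positive integer $n$ let $\mathcal{P}_n(z):=\sum_{k=0}^n \frac{(nz)^k}{k!}$ (with $0^0=1$) and $\mathcal{S}_n:=\{z\in\mathbb{C} : |\mathcal{P}_n(z)|\le 1\}$. For $\varrho>0$, $D_\varrho:=\{z\in\mathbb{C}: |z|\le\varrho\}$ is the closed disk of radius $\varrho$ centered at $0$. Here $e$ is Euler's number. *)

theory Defs
  imports "HOL-Analysis.Analysis"
begin

text \<open>Partial sums of the exponential series, rescaled by their degree.\<close>

definition exp_section :: "nat \<Rightarrow> complex \<Rightarrow> complex" where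
  "exp_section n z = (\<Sum>k=0..n. (of_nat n * z) ^ k / fact k)"

definition section_sublevel :: "nat \<Rightarrow> complex set" where
  "section_sublevel n = {z. cmod (exp_section n z) \<le> 1}"

end

theory Submission
  imports Defs
begin

text \<open>
  The coefficients \<open>n ^ k / k!\<close> of \<open>P = exp_section n\<close> form a nondecreasing sequence for \<open>k \<le> n\<close>,
  since the ratio of the coefficient of index \<open>k + 1\<close> to that of index \<open>k\<close> is \<open>n / (k + 1)\<close>. So the idea behind the Enestrom-Kakeya theorem
  applies: after multiplication by \<open>z - 1\<close>, only the leading coefficient keeps a positive sign, and
  the triangle inequality, applied to all the other terms, bounds the product from below by its
  value at the radius \<open>R = |z|\<close>. This gives
  \<open>(R - 1) * P(R) \<le> |z - 1| * |P(z)| \<le> (R + 1) * |P(z)|\<close>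
  (\<open>norm_polynomial_mono_coeffs_ge\<close>).

  Suppose now that \<open>|P(z)| \<le> 1\<close> and \<open>R > 1 + \<epsilon>\<close>. The first two terms of \<open>P(R)\<close> are
  already enough for a contradiction: they give \<open>(R - 1) * (1 + n * R) \<le> R + 1\<close>, that is,
  \<open>n * R * (R - 1) \<le> 2\<close>, whereas the left-hand side exceeds
  \<open>n * \<epsilon> \<ge> n * \<epsilon>\<^sup>2 \<ge> e\<^sup>2 > 4\<close>.
\<close>

lemma minus_one_times_polynomial:
  fixes a :: "nat \<Rightarrow> 'a::comm_ring_1"
  shows "(x - 1) * (\<Sum>k=0..n. a k * x ^ k) =
    a n * x ^ Suc n - (a 0 + (\<Sum>k=1..n. (a k - a (k - 1)) * x ^ k))"
  by (induction n) (simp_all add: algebra_simps)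

text \<open>
  Expand both sides with \<open>minus_one_times_polynomial\<close>. As the differences \<open>a k - a (k - 1)\<close> are
  nonnegative, the expansion at \<open>|z|\<close> is exactly the lower bound that the reverse triangle
  inequality gives for the expansion at \<open>z\<close>.
\<close>

lemma norm_polynomial_mono_coeffs_ge:
  fixes a :: "nat \<Rightarrow> real" and z :: complex
  assumes a0: "0 \<le> a 0" and mono: "\<And>k. k < n \<Longrightarrow> a k \<le> a (Suc k)"
  shows "(cmod z - 1) * (\<Sum>k=0..n. a k * cmod z ^ k)
    \<le> cmod (z - 1) * cmod (\<Sum>k=0..n. of_real (a k) * z ^ k)"
proof -
  have diff: "0 \<le> a k - a (k - 1)" if "k \<in> {1..n}" for k
    using mono[of "k - 1"] that by auto
  let ?S = "\<Sum>k=1..n. complex_of_real (a k - a (k - 1)) * z ^ k"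
  have "cmod ?S \<le> (\<Sum>k=1..n. (a k - a (k - 1)) * cmod z ^ k)"
    by (rule sum_norm_le) (use diff in \<open>simp add: norm_mult norm_power mult_right_mono del: of_real_diff\<close>)
  moreover have "cmod (of_real (a 0) + ?S) \<le> a 0 + cmod ?S"
    using norm_triangle_ineq[of "complex_of_real (a 0)" ?S] a0 by simp
  moreover have "a n * cmod z ^ Suc n \<le> cmod (of_real (a n) * z ^ Suc n)"
    by (simp add: norm_mult norm_power mult_right_mono)
  ultimately have "a n * cmod z ^ Suc n - (a 0 + (\<Sum>k=1..n. (a k - a (k - 1)) * cmod z ^ k))
      \<le> cmod (of_real (a n) * z ^ Suc n - (of_real (a 0) + ?S))"
    using norm_triangle_ineq2[of "of_real (a n) * z ^ Suc n" "of_real (a 0) + ?S"] by linarith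
  also have "of_real (a n) * z ^ Suc n - (of_real (a 0) + ?S)
      = (z - 1) * (\<Sum>k=0..n. of_real (a k) * z ^ k)"
    by (subst minus_one_times_polynomial) simp
  finally show ?thesis
    unfolding norm_mult by (subst minus_one_times_polynomial)
qed

lemma exp_coeff_mono:
  assumes "k < n"
  shows "real n ^ k / fact k \<le> real n ^ Suc k / fact (Suc k)"
proof -
  have "real n ^ k / fact k * 1 \<le> real n ^ k / fact k * (real n / real (Suc k))"
    by (rule mult_left_mono) (use assms in \<open>auto simp: field_simps\<close>)
  also have "\<dots> = real n ^ Suc k / fact (Suc k)"
    by (simp add: field_simps)
  finally show ?thesis by simp
qed

lemma norm_exp_section_ge:
  "(cmod z - 1) * (\<Sum>k=0..n. real n ^ k / fact k * cmod z ^ k)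
    \<le> cmod (z - 1) * cmod (exp_section n z)"
proof -
  have "exp_section n z = (\<Sum>k=0..n. of_real (real n ^ k / fact k) * z ^ k)"
    by (simp add: exp_section_def power_mult_distrib)
  then show ?thesis
    using norm_polynomial_mono_coeffs_ge[of "\<lambda>k. real n ^ k / fact k" n z] exp_coeff_mono by simp
qed

theorem theorem2p2:
  fixes \<epsilon> :: real and n :: nat
  assumes "0 < \<epsilon>" and "\<epsilon> < 1"
    and "0 < n"
    and "real n \<ge> (1.0085 * exp 1 / \<epsilon>)\<^sup>2"
  shows "section_sublevel n \<subseteq> cball 0 (1 + \<epsilon>)"
proof (rule subsetI, rule ccontr)
  fix z assume "z \<in> section_sublevel n" and "z \<notin> cball 0 (1 + \<epsilon>)"
  define R where "R = cmod z"
  have P: "cmod (exp_section n z) \<le> 1" and R: "R > 1 + \<epsilon>"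
    using \<open>z \<in> section_sublevel n\<close> \<open>z \<notin> cball 0 (1 + \<epsilon>)\<close>
    by (auto simp: section_sublevel_def R_def)
  have "(2::real) \<le> 1.0085 * exp 1"
    using exp_ge_add_one_self[of 1] by simp
  then have "2\<^sup>2 \<le> (1.0085 * exp 1 :: real)\<^sup>2"
    by (rule power_mono) simp
  also have "\<dots> \<le> real n * \<epsilon>\<^sup>2"
    using assms by (simp add: power_divide field_simps)
  also have "\<dots> \<le> real n * \<epsilon>"
    using assms by (simp add: power2_eq_square)
  finally have n\<epsilon>: "4 \<le> real n * \<epsilon>" by simp
  have "(\<Sum>k\<in>{0, 1}. real n ^ k / fact k * R ^ k) \<le> (\<Sum>k=0..n. real n ^ k / fact k * R ^ k)"
    by (rule sum_mono2) (use assms R in auto)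
  then have "(R - 1) * (1 + real n * R) \<le> (R - 1) * (\<Sum>k=0..n. real n ^ k / fact k * R ^ k)"
    using R assms by (intro mult_left_mono) auto
  also have "\<dots> \<le> cmod (z - 1) * cmod (exp_section n z)"
    using norm_exp_section_ge unfolding R_def .
  also have "\<dots> \<le> cmod (z - 1)"
    using P by (simp add: mult_left_le)
  also have "\<dots> \<le> R + 1"
    using norm_triangle_ineq4[of z 1] by (simp add: R_def)
  finally have "real n * (R - 1) * R \<le> 2"
    by (simp add: algebra_simps)
  moreover have "real n * \<epsilon> * 1 \<le> real n * (R - 1) * R"
    using R assms by (intro mult_mono) auto
  ultimately show False
    using n\<epsilon> by linarith
qed

end
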